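(* Let $A$, $B$ be finite nonempty sets, $\lambda:A\to B$ a surjective mapping, and $m\ge1$. If an $m$-ary generalized quasiorder $\rho$ on $A$ has the property $\lambda^{-1}(\lambda(\rho))=\rho$, then $\lambda(\rho)$ is a generalized quasiorder on $B$. Conversely, if $\sigma$ is an $m$-ary generalized quasiorder on $B$ and $\rho:=\lambda^{-1}(\sigma)$, then $\rho$ is a generalized quasiorder on $A$ and $\rho$ has the property $\lambda^{-1}(\lambda(\rho))=\rho$.
   Context: For a finite nonempty set $X$, a relation $\rho\subseteq X^m$ is reflexive if $(a,\dots,a)\in\rho$ for all $a\in X$; it is (generalized) transitive if for every matrix $(a_{ij})\in X^{m\times m}$ all of whose rows and all of whose columns belong to $\rho$, the diagonal $(a_{11},\dots,a_{mm})$ belongs to $\rho$. A generalized quasiorder on $X$ is a reflexive and transitive relation. For $\rho\subseteq A^m$ and $\sigma\subseteq B^m$: $\lambda(\rho):=\{(\lambda a_1,\dots,\lambda a_m)\in B^m\mid(a_1,\dots,a_m)\in\rho\}$ and $\lambda^{-1}(\sigma):=\{(a_1,\dots,a_m)\in A^m\mid(\lambda a_1,\dots,\lambda a_m)\in\sigma\}$. *)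

theory Defs
  imports "HOL-Library.NList"
begin

text \<open>
  An element of \<open>X\<^sup>m\<close> is a list of length \<open>m\<close> with entries in \<open>X\<close>, so that
  \<open>X\<^sup>m\<close> is \<^term>\<open>nlists m X\<close>. Positions are numbered from \<open>0\<close> to \<open>m - 1\<close>.
\<close>

definition rel_reflexive :: "nat \<Rightarrow> 'a set \<Rightarrow> 'a list set \<Rightarrow> bool" where
  "rel_reflexive m X \<rho> \<longleftrightarrow> (\<forall>a\<in>X. replicate m a \<in> \<rho>)"

text \<open>An \<open>m \<times> m\<close> matrix is a function of two indices, of which only the values at indices below
  \<open>m\<close> matter.\<close>

definition rel_transitive :: "nat \<Rightarrow> 'a set \<Rightarrow> 'a list set \<Rightarrow> bool" where
  "rel_transitive m X \<rho> \<longleftrightarrow>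
     (\<forall>a :: nat \<Rightarrow> nat \<Rightarrow> 'a.
        (\<forall>i<m. \<forall>j<m. a i j \<in> X) \<longrightarrow>
        (\<forall>i<m. map (\<lambda>j. a i j) [0..<m] \<in> \<rho>) \<longrightarrow>
        (\<forall>j<m. map (\<lambda>i. a i j) [0..<m] \<in> \<rho>) \<longrightarrow>
        map (\<lambda>i. a i i) [0..<m] \<in> \<rho>)"

definition gen_quasiorder :: "nat \<Rightarrow> 'a set \<Rightarrow> 'a list set \<Rightarrow> bool" where
  "gen_quasiorder m X \<rho> \<longleftrightarrow>
     \<rho> \<subseteq> nlists m X \<and> rel_reflexive m X \<rho> \<and> rel_transitive m X \<rho>"

definition rel_image :: "('a \<Rightarrow> 'b) \<Rightarrow> 'a list set \<Rightarrow> 'b list set" where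
  "rel_image l \<rho> = map l ` \<rho>"

definition rel_preimage :: "nat \<Rightarrow> 'a set \<Rightarrow> ('a \<Rightarrow> 'b) \<Rightarrow> 'b list set \<Rightarrow> 'a list set" where
  "rel_preimage m A l \<sigma> = {as \<in> nlists m A. map l as \<in> \<sigma>}"

end

theory Submission
  imports Defs
begin

text \<open>Applying \<open>l\<close> entrywise to a matrix commutes with taking rows, columns and
  the diagonal, and it sends constant tuples to constant tuples. Hence both closure conditions pull
  back along \<open>l\<close> (\<open>gen_quasiorder_rel_preimage\<close>). They push forward as
  soon as a matrix over \<open>B\<close> can be lifted to a matrix over \<open>A\<close> whose rows
  and columns all lie in \<rho>; saturation of \<rho> makes every entrywise lift suitable
  (\<open>gen_quasiorder_rel_image\<close>). That a preimage is itself saturated is the usual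
  identity for image and preimage (\<open>rel_preimage_image_preimage\<close>).\<close>

lemma map_upt_in_nlists_iff: "map f [0..<m] \<in> nlists m A \<longleftrightarrow> (\<forall>i<m. f i \<in> A)"
  by (simp only: nlists_def) (auto simp: image_subset_iff)

lemma rel_image_preimage_subset: "rel_image l (rel_preimage m A l \<sigma>) \<subseteq> \<sigma>"
  by (auto simp: rel_image_def rel_preimage_def)

text \<open>Image followed by preimage can only enlarge a relation over \<open>A\<close>, and
  preimage followed by image can only shrink \<sigma>; the two inclusions meet here.\<close>

lemma rel_preimage_image_preimage:
  "rel_preimage m A l (rel_image l (rel_preimage m A l \<sigma>)) = rel_preimage m A l \<sigma>"
  using rel_image_preimage_subset[of l m A \<sigma>]
  by (auto simp: rel_image_def rel_preimage_def)

lemma gen_quasiorder_rel_preimage: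
  fixes l :: "'a \<Rightarrow> 'b"
  assumes \<sigma>: "gen_quasiorder m B \<sigma>" and l: "l ` A \<subseteq> B"
  shows "gen_quasiorder m A (rel_preimage m A l \<sigma>)"
  unfolding gen_quasiorder_def
proof (intro conjI)
  show "rel_preimage m A l \<sigma> \<subseteq> nlists m A"
    by (auto simp: rel_preimage_def)
  show "rel_reflexive m A (rel_preimage m A l \<sigma>)"
    unfolding rel_reflexive_def
  proof
    fix x assume "x \<in> A"
    then have "replicate m (l x) \<in> \<sigma>"
      using \<sigma> l unfolding gen_quasiorder_def rel_reflexive_def by blast
    then show "replicate m x \<in> rel_preimage m A l \<sigma>"
      using \<open>x \<in> A\<close> by (auto simp: rel_preimage_def intro!: nlistsI)
  qed
  show "rel_transitive m A (rel_preimage m A l \<sigma>)"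
    unfolding rel_transitive_def
  proof (intro allI impI)
    fix a :: "nat \<Rightarrow> nat \<Rightarrow> 'a"
    assume a: "\<forall>i<m. \<forall>j<m. a i j \<in> A"
      and rows: "\<forall>i<m. map (\<lambda>j. a i j) [0..<m] \<in> rel_preimage m A l \<sigma>"
      and cols: "\<forall>j<m. map (\<lambda>i. a i j) [0..<m] \<in> rel_preimage m A l \<sigma>"
    have "\<forall>i<m. \<forall>j<m. l (a i j) \<in> B"
      using a l by blast
    moreover have "\<forall>i<m. map (\<lambda>j. l (a i j)) [0..<m] \<in> \<sigma>"
      and "\<forall>j<m. map (\<lambda>i. l (a i j)) [0..<m] \<in> \<sigma>"
      using rows cols by (simp_all add: rel_preimage_def comp_def)
    moreover have "rel_transitive m B \<sigma>"
      using \<sigma> by (simp add: gen_quasiorder_def)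
    ultimately have "map (\<lambda>i. l (a i i)) [0..<m] \<in> \<sigma>"
      \<comment> \<open>Transitivity of \<sigma> is applied to the entrywise image of the
        matrix.\<close>
      unfolding rel_transitive_def by (elim allE[where x = "\<lambda>i j. l (a i j)"]) simp
    then show "map (\<lambda>i. a i i) [0..<m] \<in> rel_preimage m A l \<sigma>"
      using a by (simp add: rel_preimage_def map_upt_in_nlists_iff comp_def)
  qed
qed

text \<open>Saturation of \<open>\<rho>\<close> makes membership in its image independent of the chosen lifts, so the
  entries of a matrix over \<open>l ` A\<close> can be lifted one by one.\<close>

lemma gen_quasiorder_rel_image:
  fixes l :: "'a \<Rightarrow> 'b"
  assumes \<rho>: "gen_quasiorder m A \<rho>" and sat: "rel_preimage m A l (rel_image l \<rho>) = \<rho>"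
  shows "gen_quasiorder m (l ` A) (rel_image l \<rho>)"
  unfolding gen_quasiorder_def
proof (intro conjI)
  show "rel_image l \<rho> \<subseteq> nlists m (l ` A)"
  proof
    fix bs assume "bs \<in> rel_image l \<rho>"
    then obtain as where "as \<in> \<rho>" "bs = map l as"
      unfolding rel_image_def ..
    moreover from this have "length as = m" "set as \<subseteq> A"
      using \<rho> by (auto simp only: gen_quasiorder_def nlists_def)
    ultimately show "bs \<in> nlists m (l ` A)"
      by (auto intro!: nlistsI imageI)
  qed
  show "rel_reflexive m (l ` A) (rel_image l \<rho>)"
    unfolding rel_reflexive_def
  proof
    fix y assume "y \<in> l ` A"
    then obtain x where "x \<in> A" "y = l x" ..
    then have "replicate m x \<in> \<rho>" and "replicate m y = map l (replicate m x)"
      using \<rho> by (simp_all add: gen_quasiorder_def rel_reflexive_def)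
    then show "replicate m y \<in> rel_image l \<rho>"
      unfolding rel_image_def by (rule rev_image_eqI)
  qed
  show "rel_transitive m (l ` A) (rel_image l \<rho>)"
    unfolding rel_transitive_def
  proof (intro allI impI)
    fix b :: "nat \<Rightarrow> nat \<Rightarrow> 'b"
    assume b: "\<forall>i<m. \<forall>j<m. b i j \<in> l ` A"
      and rows: "\<forall>i<m. map (\<lambda>j. b i j) [0..<m] \<in> rel_image l \<rho>"
      and cols: "\<forall>j<m. map (\<lambda>i. b i j) [0..<m] \<in> rel_image l \<rho>"
    \<comment> \<open>Rows and columns must be lifted by one common matrix. The tuples in \<rho>
      that witness membership of a row and of a column in the image may disagree at the shared
      entry, so a preimage is fixed for each entry instead.\<close>
    define a where "a i j = inv_into A l (b i j)" for i j
    have aA: "a i j \<in> A" and la: "l (a i j) = b i j" if "i < m" "j < m" for i j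
      using b that by (auto simp: a_def inv_into_into f_inv_into_f)
    \<comment> \<open>The tuple of chosen preimages need not be the witness from \<rho>, but it has
      the same image, so it lies in the saturation of \<rho>, which is \<rho>.\<close>
    have lift: "map f [0..<m] \<in> \<rho>"
      if "\<And>k. k < m \<Longrightarrow> f k \<in> A" and "map (\<lambda>k. l (f k)) [0..<m] \<in> rel_image l \<rho>" for f
    proof -
      have "map f [0..<m] \<in> rel_preimage m A l (rel_image l \<rho>)"
        using that by (simp add: rel_preimage_def map_upt_in_nlists_iff comp_def)
      then show ?thesis by (simp add: sat)
    qed
    have "map (\<lambda>j. a i j) [0..<m] \<in> \<rho>" if "i < m" for i
    proof (rule lift)
      have "map (\<lambda>j. l (a i j)) [0..<m] = map (\<lambda>j. b i j) [0..<m]"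
        using that la by auto
      also have "\<dots> \<in> rel_image l \<rho>"
        using rows that by blast
      finally show "map (\<lambda>j. l (a i j)) [0..<m] \<in> rel_image l \<rho>" .
    qed (use that aA in auto)
    moreover have "map (\<lambda>i. a i j) [0..<m] \<in> \<rho>" if "j < m" for j
    proof (rule lift)
      have "map (\<lambda>i. l (a i j)) [0..<m] = map (\<lambda>i. b i j) [0..<m]"
        using that la by auto
      also have "\<dots> \<in> rel_image l \<rho>"
        using cols that by blast
      finally show "map (\<lambda>i. l (a i j)) [0..<m] \<in> rel_image l \<rho>" .
    qed (use that aA in auto)
    moreover have "rel_transitive m A \<rho>"
      using \<rho> by (simp add: gen_quasiorder_def)
    ultimately have "map (\<lambda>i. a i i) [0..<m] \<in> \<rho>"
      using aA unfolding rel_transitive_def by (elim allE[where x = a]) simp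
    then have "map l (map (\<lambda>i. a i i) [0..<m]) \<in> rel_image l \<rho>"
      unfolding rel_image_def by (rule imageI)
    also have "map l (map (\<lambda>i. a i i) [0..<m]) = map (\<lambda>i. b i i) [0..<m]"
      using la by auto
    finally show "map (\<lambda>i. b i i) [0..<m] \<in> rel_image l \<rho>" .
  qed
qed

theorem proposition2p5:
  fixes A :: "'a set" and B :: "'b set" and l :: "'a \<Rightarrow> 'b" and m :: nat
  assumes "finite A" and "A \<noteq> {}"
    and "finite B" and "B \<noteq> {}"
    and "l ` A = B"
    and "m \<ge> 1"
  shows "(\<forall>\<rho>. gen_quasiorder m A \<rho> \<and> rel_preimage m A l (rel_image l \<rho>) = \<rho>
              \<longrightarrow> gen_quasiorder m B (rel_image l \<rho>)) \<and>
         (\<forall>\<sigma> \<rho>. gen_quasiorder m B \<sigma> \<and> \<rho> = rel_preimage m A l \<sigma>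
              \<longrightarrow> gen_quasiorder m A \<rho> \<and> rel_preimage m A l (rel_image l \<rho>) = \<rho>)"
proof (intro conjI allI impI; elim conjE)
  fix \<rho>
  assume "gen_quasiorder m A \<rho>" "rel_preimage m A l (rel_image l \<rho>) = \<rho>"
  then show "gen_quasiorder m B (rel_image l \<rho>)"
    \<comment> \<open>Surjectivity enters here: reflexivity on \<open>B\<close> asks for a constant
      tuple at every element of \<open>B\<close>, and the image supplies those at values of
      \<open>l\<close> on \<open>A\<close>.\<close>
    unfolding \<open>l ` A = B\<close>[symmetric] by (rule gen_quasiorder_rel_image)
next
  fix \<sigma> \<rho>
  assume "gen_quasiorder m B \<sigma>" and \<rho>: "\<rho> = rel_preimage m A l \<sigma>"
  then show "gen_quasiorder m A \<rho>"
    using \<open>l ` A = B\<close> by (simp add: gen_quasiorder_rel_preimage)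
  show "rel_preimage m A l (rel_image l \<rho>) = \<rho>"
    unfolding \<rho> by (rule rel_preimage_image_preimage)
qed

end
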